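(* The areas $A_{n,n+1}$ of the segments of the Binet-Fibonacci oscillating curve satisfy $$A_\infty:=\lim_{n\to\infty}|A_{n,n+1}|=\frac{2}{5\pi}\ln(\varphi).$$
   Context: Let $\varphi=\frac{1+\sqrt5}{2}$. The Binet-Fibonacci (oscillating) curve is the plane curve $t\mapsto (x(t),y(t))$, $t>0$, with $$x(t)=\frac{1}{\varphi+\varphi^{-1}}\left(e^{t\ln\varphi}-\cos(\pi t)e^{-t\ln\varphi}\right),\qquad y(t)=-\frac{1}{\varphi+\varphi^{-1}}\sin(\pi t)e^{-t\ln\varphi}.$$ It is $F_t=\frac{\varphi^t-\varphi'^t}{\varphi-\varphi'}$ with $\varphi'=-1/\varphi$ and the branch $(-1)^t=e^{i\pi t}$, written as $F_t=x(t)+iy(t)$. For a positive integer $n$, the signed area of the segment between parameters $n$ and $n+1$ is (with the paper's sign convention) $$A_{n,n+1}=-\frac12\int_n^{n+1}\bigl(x\dot y-y\dot x\bigr)\,dt .$$ *)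

theory Defs
  imports "HOL-Analysis.Analysis"
begin

definition golden_ratio :: real where
  "golden_ratio = (1 + sqrt 5) / 2"

(* Real and imaginary part of the Binet formula
   F_t = (golden_ratio^t - (-1/golden_ratio)^t) / (golden_ratio + 1/golden_ratio)
   for real t, with the branch (-1)^t = exp (i*pi*t).  The curve is considered for t > 0 only;
   the coordinate functions are total because the formulas make sense for all real t. *)

definition fib_curve_x :: "real \<Rightarrow> real" where
  "fib_curve_x t = 1 / (golden_ratio + inverse golden_ratio) *
     (exp (t * ln golden_ratio) - cos (pi * t) * exp (- t * ln golden_ratio))"

definition fib_curve_y :: "real \<Rightarrow> real" where
  "fib_curve_y t = - (1 / (golden_ratio + inverse golden_ratio)) *
     sin (pi * t) * exp (- t * ln golden_ratio)"

(* The sign is opposite to the usual orientation convention. *)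
definition signed_area :: "(real \<Rightarrow> real) \<Rightarrow> (real \<Rightarrow> real) \<Rightarrow> real \<Rightarrow> real \<Rightarrow> real" where
  "signed_area x y a b = - (1 / 2) * integral {a..b} (\<lambda>t. x t * deriv y t - y t * deriv x t)"

definition fib_segment_area :: "nat \<Rightarrow> real" where
  "fib_segment_area n = signed_area fib_curve_x fib_curve_y (real n) (real (n + 1))"

end

(* With L = ln golden_ratio, the products of growing and decaying exponentials in the integrand
   x y' - y x' cancel, leaving (2 L sin (pi t) - pi cos (pi t) + pi exp (- 2 L t)) / 5.
   Over [n, n + 1] the sine contributes 4 L (-1)^n / (5 pi), the cosine integrates to 0, and
   the exponential part vanishes as n grows. *)
theory Submission
  imports Defs
begin

lemma golden_ratio_gt_1: "golden_ratio > 1"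
proof -
  have "sqrt 5 > sqrt 1" by (subst real_sqrt_less_iff) simp
  then show ?thesis by (simp add: golden_ratio_def)
qed

lemma ln_golden_ratio_pos: "ln golden_ratio > 0"
  using golden_ratio_gt_1 by simp

text \<open>Makes the normalising factor of both coordinates \<open>1 / sqrt 5\<close>, whose square
  is the 1/5 in the area integrand.\<close>

lemma golden_ratio_plus_inverse: "golden_ratio + inverse golden_ratio = sqrt 5"
proof -
  \<comment> \<open>Rationalising the denominator: (sqrt 5 + 1)(sqrt 5 - 1) = 4.\<close>
  have "inverse golden_ratio = (sqrt 5 - 1) / 2"
  proof (rule inverse_unique)
    show "golden_ratio * ((sqrt 5 - 1) / 2) = 1"
      by (simp add: golden_ratio_def algebra_simps)
  qed
  then show ?thesis by (simp add: golden_ratio_def field_simps)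
qed

lemma fib_curve_x_has_derivative:
  "(fib_curve_x has_real_derivative
     1 / sqrt 5 * (ln golden_ratio * exp (t * ln golden_ratio)
       + (pi * sin (pi * t) + ln golden_ratio * cos (pi * t)) * exp (- t * ln golden_ratio))) (at t)"
  unfolding fib_curve_x_def[abs_def] golden_ratio_plus_inverse
  by (rule derivative_eq_intros refl)+ (simp add: algebra_simps)

lemma fib_curve_y_has_derivative:
  "(fib_curve_y has_real_derivative
     - (1 / sqrt 5) * (pi * cos (pi * t) - ln golden_ratio * sin (pi * t))
       * exp (- t * ln golden_ratio)) (at t)"
  unfolding fib_curve_y_def[abs_def] golden_ratio_plus_inverse
  by (rule derivative_eq_intros refl)+ (simp add: algebra_simps)

lemma fib_curve_area_integrand:
  "fib_curve_x t * deriv fib_curve_y t - fib_curve_y t * deriv fib_curve_x t =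
   (2 * ln golden_ratio * sin (pi * t) - pi * cos (pi * t)
     + pi * exp (- 2 * ln golden_ratio * t)) / 5"
proof -
  define L where "L = ln golden_ratio"
  define k where "k = 1 / sqrt 5"
  define s where "s = sin (pi * t)"
  define c where "c = cos (pi * t)"
  define E where "E = exp (t * L)"
  define e where "e = exp (- t * L)"
  have k: "k * k = 1 / 5" by (simp add: k_def)
  have Ee: "E * e = 1" by (simp add: E_def e_def flip: exp_add)
  have ee: "exp (- 2 * L * t) = e * e" by (simp add: e_def mult_ac flip: exp_add)
  have sc: "s * s + c * c = 1" by (simp add: s_def c_def flip: power2_eq_square)
  have "fib_curve_x t * deriv fib_curve_y t - fib_curve_y t * deriv fib_curve_x t =
      k * (E - c * e) * (- k * (pi * c - L * s) * e)
      - (- k * s * e) * (k * (L * E + (pi * s + L * c) * e))"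
    unfolding DERIV_imp_deriv[OF fib_curve_x_has_derivative]
      DERIV_imp_deriv[OF fib_curve_y_has_derivative]
    by (simp add: fib_curve_x_def fib_curve_y_def golden_ratio_plus_inverse
        L_def k_def s_def c_def E_def e_def)
  \<comment> \<open>The two terms in \<open>L * s * c * (e * e)\<close> cancel. The remaining ones
    are grouped so that \<open>k * k\<close>, \<open>E * e\<close> and \<open>s * s + c * c\<close>
    appear, all of them constants.\<close>
  also have "\<dots> = (k * k) * ((2 * L * s - pi * c) * (E * e) + pi * (s * s + c * c) * (e * e))"
    by (simp add: algebra_simps)
  finally show ?thesis
    unfolding k Ee sc L_def[symmetric] ee s_def[symmetric] c_def[symmetric] by simp
qed

lemma fib_segment_area_eq:
  "fib_segment_area n = - (1 / 10) *
     (4 * ln golden_ratio / pi * (-1) ^ n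
       + pi / (2 * ln golden_ratio) * (1 - exp (- 2 * ln golden_ratio))
           * exp (- 2 * ln golden_ratio) ^ n)"
proof -
  define L where "L = ln golden_ratio"
  \<comment> \<open>An antiderivative of the integrand, found term by term; dividing by
    \<open>2 * L\<close> is legitimate because \<open>L > 0\<close>.\<close>
  define G where "G t = (- 2 * L / pi * cos (pi * t) - sin (pi * t)
      - pi / (2 * L) * exp (- 2 * L * t)) / 5" for t
  have L: "L > 0" by (simp add: L_def ln_golden_ratio_pos)
  have "(G has_real_derivative (2 * L * sin (pi * t) - pi * cos (pi * t)
          + pi * exp (- 2 * L * t)) / 5) (at t)" for t
    unfolding G_def[abs_def] using L
    by - ((rule derivative_eq_intros refl)+, simp_all add: field_simps)
  then have "((\<lambda>t. (2 * L * sin (pi * t) - pi * cos (pi * t)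
          + pi * exp (- 2 * L * t)) / 5) has_integral G (real (n + 1)) - G (real n))
      {real n..real (n + 1)}"
    by (intro fundamental_theorem_of_calculus)
       (auto simp flip: has_real_derivative_iff_has_vector_derivative
             intro: has_field_derivative_at_within)
  then have area: "fib_segment_area n = - (1 / 2) * (G (real (n + 1)) - G (real n))"
    unfolding fib_segment_area_def signed_area_def fib_curve_area_integrand L_def
    by (simp only: integral_unique)
  \<comment> \<open>At integers the sine vanishes, the cosine is a sign and the exponential is a
    geometric sequence.\<close>
  have G: "G (real m) = (- 2 * L / pi * (-1) ^ m - pi / (2 * L) * exp (- 2 * L) ^ m) / 5"
    for m
    unfolding G_def
    by (simp add: mult_ac flip: exp_of_nat_mult)
  show ?thesis
    unfolding area G L_def[symmetric] using L by (simp add: field_simps)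
qed

theorem mainTheorem2:
  shows "(\<lambda>n. \<bar>fib_segment_area n\<bar>) \<longlonglongrightarrow> 2 / (5 * pi) * ln golden_ratio"
proof -
  define L where "L = ln golden_ratio"
  define q where "q = exp (- 2 * L)"
  have L: "L > 0" by (simp add: L_def ln_golden_ratio_pos)
  then have q: "\<bar>q\<bar> < 1" "\<bar>- q\<bar> < 1" by (simp_all add: q_def)
  \<comment> \<open>Multiplying by \<open>(-1) ^ n\<close> keeps the absolute value but moves the
    alternating sign from the main term to the decaying one. The expression inside the bars then
    converges, so continuity of the absolute value gives the limit.\<close>
  have eq: "\<bar>fib_segment_area n\<bar> =
      \<bar>1 / 10 * (4 * L / pi + pi / (2 * L) * (1 - q) * (- q) ^ n)\<bar>" for n
  proof -
    have "\<bar>fib_segment_area n\<bar> = \<bar>fib_segment_area n * (-1) ^ n\<bar>"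
      by (simp add: abs_mult power_abs)
    also have "fib_segment_area n * (-1) ^ n =
        - (1 / 10) * (4 * L / pi * ((-1) ^ n * (-1) ^ n)
          + pi / (2 * L) * (1 - q) * (q ^ n * (-1) ^ n))"
      unfolding fib_segment_area_eq L_def q_def by (simp only: distrib_right mult.assoc)
    also have "(-1) ^ n * (-1) ^ n = (1::real)"
      by (simp flip: power_mult_distrib)
    also have "q ^ n * (-1) ^ n = (- q) ^ n"
      by (simp flip: power_mult_distrib)
    finally show ?thesis by (simp only: mult_minus_left abs_minus_cancel mult_1_right)
  qed
  have "(\<lambda>n. \<bar>1 / 10 * (4 * L / pi + pi / (2 * L) * (1 - q) * (- q) ^ n)\<bar>)
      \<longlonglongrightarrow> \<bar>1 / 10 * (4 * L / pi + pi / (2 * L) * (1 - q) * 0)\<bar>"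
    using q(2) by (intro tendsto_intros LIMSEQ_abs_realpow_zero2)
  \<comment> \<open>The limit inside the bars is \<open>4 * L / (10 * pi)\<close>, which is positive
    since \<open>L > 0\<close>.\<close>
  then show ?thesis
    unfolding eq using L by (simp add: L_def field_simps)
qed

end
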